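(* Let $(\Lambda,\langle\cdot,\cdot\rangle)$ be a Euclidean lattice, let $\mathcal{F}$ be a set of representatives for the pairs of opposite facet vectors of $\Lambda$, and let $\mathcal{L}_{\mathcal{F}}$ be a set of representatives for the pairs of opposite line relations. Let $\pi:\mathbb{Z}[\mathcal{F}]\to\Lambda$ be the homomorphism $\sum_{f\in\mathcal{F}}a_f[f]\mapsto\sum_{f\in\mathcal{F}}a_f f$, and let $\iota:\mathbb{Z}[\mathcal{L}_{\mathcal{F}}]\to\mathbb{Z}[\mathcal{F}]$ be the natural homomorphism sending the basis element indexed by $r\in\mathcal{L}_{\mathcal{F}}$ to $r\in\mathbb{Z}[\mathcal{F}]$. Then the sequence $$\mathbb{Z}[\mathcal{L}_{\mathcal{F}}]\overset{\iota}{\longrightarrow}\mathbb{Z}[\mathcal{F}]\overset{\pi}{\longrightarrow}\Lambda\longrightarrow 0$$ is exact. In particular, $\iota$ surjects onto $\ker(\pi)$, and $\ker(\pi)=\langle\mathcal{L}_{\mathcal{F}}\rangle$ is the subgroup of $\mathbb{Z}[\mathcal{F}]$ generated by line relations.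
   Context: A Euclidean lattice is a free abelian group $\Lambda$ of finite rank $d$ together with a positive definite symmetric bilinear form $\langle\cdot,\cdot\rangle$ on $\mathbb{E}=\Lambda\otimes_{\mathbb{Z}}\mathbb{R}$. Its Voronoï cell (at the origin) is $$V_\Lambda=\{x\in\mathbb{E}\mid \langle x,g\rangle\le\tfrac12\langle g,g\rangle\text{ for all }g\in\Lambda\}.$$ A vector $f\in\Lambda$ is a facet vector (also called a relevant or strict Voronoï vector) if the hyperplane $\{x\in\mathbb{E}\mid\langle x,f\rangle=\frac12\langle f,f\rangle\}$ contains a facet (a face of dimension $d-1$) of $V_\Lambda$. Facet vectors come in opposite pairs $\pm f$; $\mathcal{F}$ contains exactly one vector from each pair. For a set $\mathcal{E}$, $\mathbb{Z}[\mathcal{E}]$ denotes the free abelian group on $\mathcal{E}$. The basis of $\mathbb{Z}[\mathcal{F}]$ is written $([f])_{f\in\mathcal{F}}$. A line relation is an element of $\ker(\pi)$ of the form $\varepsilon_k[f_k]+\varepsilon_\ell[f_\ell]+\varepsilon_m[f_m]$, where $f_k,f_\ell,f_m$ are three elements of $\mathcal{F}$ and $\varepsilon_k,\varepsilon_\ell,\varepsilon_m\in\{\pm1\}$. Line relations come in opposite pairs; $\mathcal{L}_{\mathcal{F}}\subset\mathbb{Z}[\mathcal{F}]$ contains exactly one element from each pair. *)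

theory Defs
  imports "HOL-Analysis.Analysis" "HOL-Algebra.Free_Abelian_Groups"
begin

text \<open>
  A Euclidean lattice is given by the integer combinations of a finite, linearly independent
  subset of a Euclidean space, with the form inherited from the inner product. The real vector
  space obtained from the lattice by extension of scalars is then its real span, which need not
  be the whole ambient space. So every rank occurs, including rank zero.
\<close>

definition euclidean_lattice :: "'a::euclidean_space set \<Rightarrow> bool" where
  "euclidean_lattice \<Lambda> \<longleftrightarrow>
     (\<exists>B. finite B \<and> independent B \<and> \<Lambda> = {\<Sum>b\<in>B. of_int (c b) *\<^sub>R b | c :: 'a \<Rightarrow> int. True})"

definition lattice_group :: "'a::euclidean_space set \<Rightarrow> 'a monoid" where
  "lattice_group \<Lambda> = \<lparr>carrier = \<Lambda>, monoid.mult = (+), one = 0\<rparr>"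

definition voronoi_cell :: "'a::euclidean_space set \<Rightarrow> 'a set" where
  "voronoi_cell \<Lambda> = {x \<in> span \<Lambda>. \<forall>g\<in>\<Lambda>. x \<bullet> g \<le> (g \<bullet> g) / 2}"

text \<open>
  The vector 0 has to be excluded explicitly: for \<open>f = 0\<close> the equation below describes
  all of \<open>span \<Lambda>\<close> and not a hyperplane.
\<close>

definition facet_vector :: "'a::euclidean_space set \<Rightarrow> 'a \<Rightarrow> bool" where
  "facet_vector \<Lambda> f \<longleftrightarrow>
     f \<in> \<Lambda> \<and> f \<noteq> 0 \<and>
     (\<exists>G. G facet_of voronoi_cell \<Lambda> \<and> G \<subseteq> {x \<in> span \<Lambda>. x \<bullet> f = (f \<bullet> f) / 2})"

definition opposite_pair_reps :: "'b::group_add set \<Rightarrow> 'b set \<Rightarrow> bool" where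
  "opposite_pair_reps R S \<longleftrightarrow> R \<subseteq> S \<and> (\<forall>x\<in>S. \<exists>!y. y \<in> R \<inter> {x, - x})"

text \<open>
  The homomorphism \<open>\<pi>\<close> from the free abelian group on lattice vectors to the lattice, and the
  homomorphism \<open>\<iota>\<close> sending the basis element indexed by a relation to that relation.
\<close>

definition frag_eval :: "('a::real_vector \<Rightarrow>\<^sub>0 int) \<Rightarrow> 'a" where
  "frag_eval z = (\<Sum>f\<in>Poly_Mapping.keys z. of_int (Poly_Mapping.lookup z f) *\<^sub>R f)"

definition relation_incl :: "(('a \<Rightarrow>\<^sub>0 int) \<Rightarrow>\<^sub>0 int) \<Rightarrow> ('a \<Rightarrow>\<^sub>0 int)" where
  "relation_incl = frag_extend (\<lambda>r. r)"

definition line_relations :: "'a::euclidean_space set \<Rightarrow> 'a set \<Rightarrow> ('a \<Rightarrow>\<^sub>0 int) set" where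
  "line_relations \<Lambda> F =
     {r \<in> kernel (free_Abelian_group F) (lattice_group \<Lambda>) frag_eval.
        \<exists>fk\<in>F. \<exists>fl\<in>F. \<exists>fm\<in>F. \<exists>ek\<in>{1, -1}. \<exists>el\<in>{1, -1}. \<exists>em\<in>{1, -1}.
          fk \<noteq> fl \<and> fk \<noteq> fm \<and> fl \<noteq> fm \<and>
          r = frag_cmul ek (frag_of fk) + frag_cmul el (frag_of fl) + frag_cmul em (frag_of fm)}"

text \<open>
  Exactness at \<open>H\<close> of \<open>G \<rightarrow> H \<rightarrow> K\<close>; the library's \<open>exact_seq\<close> requires all groups in the
  sequence to have the same element type.
\<close>

definition exact_at ::
  "'a monoid \<Rightarrow> ('a \<Rightarrow> 'b) \<Rightarrow> 'b monoid \<Rightarrow> ('b \<Rightarrow> 'c) \<Rightarrow> 'c monoid \<Rightarrow> bool" where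
  "exact_at G f H g K \<longleftrightarrow> group_hom G H f \<and> group_hom H K g \<and> f ` carrier G = kernel H K g"

end

theory Submission
  imports Defs
begin

text \<open>
  A lattice vector is a facet vector iff it is indecomposable, that is, not a sum of two nonzero
  lattice vectors \<open>x\<close>, \<open>y\<close> with \<open>x \<bullet> y \<ge> 0\<close>. Since the summands of such a decomposition are
  shorter, decomposing repeatedly writes every lattice vector as a sum of signed facet vectors.
  The point is that the outcome is additive modulo line relations: the three outcomes for a
  triangle \<open>x + y + z = 0\<close> add up to a combination of line relations. This goes by induction on
  the larger of the sum of the squared side lengths and twice the largest squared side length.
  A triangle that is not acute compares two decompositions of its longest side, say \<open>x + y = z + w\<close>,
  and \<open>x - z\<close> or \<open>x - w\<close> links the two by a pair of smaller triangles.
  An acute triangle with a decomposable side is cut into two smaller ones by a decomposition of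
  that side. An acute triangle with three indecomposable sides is a line relation.
\<close>

subsection \<open>Splitting triangles\<close>

text \<open>A real measure need not be well-founded. When sublevel sets are finite, the number of
  elements of strictly smaller measure is a natural number, and it drops whenever the measure
  does.\<close>

lemma real_measure_induct [consumes 1, case_names finite step]:
  fixes m :: "'b \<Rightarrow> real"
  assumes "t \<in> S"
    and fin: "\<And>M. finite {s \<in> S. m s \<le> M}"
    and step: "\<And>t. t \<in> S \<Longrightarrow> (\<And>s. s \<in> S \<Longrightarrow> m s < m t \<Longrightarrow> P s) \<Longrightarrow> P t"
  shows "P t"
  using \<open>t \<in> S\<close>
proof (induction "card {s \<in> S. m s < m t}" arbitrary: t rule: less_induct)
  case less
  show ?case
  proof (rule step[OF less.prems])
    fix s assume s: "s \<in> S" "m s < m t"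
    have "finite {s \<in> S. m s < m t}"
      by (rule finite_subset[OF _ fin[of "m t"]]) auto
    moreover have "{r \<in> S. m r < m s} \<subset> {s \<in> S. m s < m t}"
      using s by force
    ultimately have "card {r \<in> S. m r < m s} < card {s \<in> S. m s < m t}"
      by (rule psubset_card_mono)
    then show "P s" using less.hyps s by blast
  qed
qed

text \<open>
  The sum of squares alone need not decrease for obtuse triangles, so twice the largest square is
  used there; the two agree for right triangles, and the maximum selects the relevant one.
\<close>

definition triangle_size :: "'a::real_inner \<Rightarrow> 'a \<Rightarrow> 'a \<Rightarrow> real" where
  "triangle_size x y z =
     max (x \<bullet> x + y \<bullet> y + z \<bullet> z) (2 * max (x \<bullet> x) (max (y \<bullet> y) (z \<bullet> z)))"

lemma triangle_size_less_iff:
  "triangle_size x y z < c \<longleftrightarrow>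
     x \<bullet> x + y \<bullet> y + z \<bullet> z < c \<and> 2 * (x \<bullet> x) < c \<and> 2 * (y \<bullet> y) < c \<and> 2 * (z \<bullet> z) < c"
  by (auto simp: triangle_size_def)

lemma le_triangle_size:
  "x \<bullet> x + y \<bullet> y + z \<bullet> z \<le> triangle_size x y z" "2 * (x \<bullet> x) \<le> triangle_size x y z"
  "2 * (y \<bullet> y) \<le> triangle_size x y z" "2 * (z \<bullet> z) \<le> triangle_size x y z"
  by (auto simp: triangle_size_def)

text \<open>Put \<open>v = x + y\<close>. The angle conditions make \<open>x\<close>,
  \<open>y\<close>, \<open>z\<close>, \<open>w\<close> all shorter than \<open>v\<close>. A triangle
  of the first pair and one of the second share one of these vectors, say \<open>s\<close>, and
  their sums of squares add up to at most \<open>2 * (s \<bullet> s) + 2 * (v \<bullet> v) < 4 * (v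
  \<bullet> v)\<close>. So they cannot both reach \<open>n\<close>, and the sums of one whole pair
  stay below it.\<close>

lemma quadrilateral_split:
  fixes x y z w :: "'a::real_inner"
  assumes sum: "x + y = z + w" and nz: "x \<noteq> 0" "y \<noteq> 0" "z \<noteq> 0" "w \<noteq> 0"
    and obt: "x \<bullet> y \<ge> 0" "z \<bullet> w \<ge> 0"
  defines "n \<equiv> 2 * ((x + y) \<bullet> (x + y))"
  shows "triangle_size x (- z) (z - x) < n \<and> triangle_size y (- w) (w - y) < n \<or>
         triangle_size x (- w) (w - x) < n \<and> triangle_size y (- z) (z - y) < n"
proof -
  have w: "w = x + y - z" using sum by (simp add: algebra_simps)
  have pos: "x \<bullet> x > 0" "y \<bullet> y > 0" "z \<bullet> z > 0" "w \<bullet> w > 0" using nz by auto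
  show ?thesis
  proof (cases "x = z \<or> x = w")
    case True
    then show ?thesis
    proof
      assume "x = z"
      then have "y = w" using sum by simp
      with \<open>x = z\<close> show ?thesis using pos obt unfolding n_def triangle_size_less_iff
        by (simp add: inner_add inner_diff inner_commute del: inner_gt_zero_iff)
    next
      assume "x = w"
      then have "y = z" using sum by simp
      with \<open>x = w\<close> show ?thesis using pos obt unfolding n_def triangle_size_less_iff
        by (simp add: inner_add inner_diff inner_commute del: inner_gt_zero_iff)
    qed
  next
    case False
    \<comment> \<open>By the parallelogram law these two numbers add up to at most
      \<open>(x + y) \<bullet> (x + y)\<close>; as both are positive, each is strictly
      smaller.\<close>
    then have "(x - z) \<bullet> (x - z) > 0" "(x - w) \<bullet> (x - w) > 0" by auto
    then show ?thesis using pos obt unfolding n_def triangle_size_less_iff w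
      by (simp add: inner_add inner_diff inner_commute del: inner_gt_zero_iff) argo
  qed
qed

text \<open>The first pair is smaller as soon as \<open>b \<bullet> y\<close>,
  \<open>a \<bullet> z\<close> and their sum are less than \<open>a \<bullet> b\<close>; the second
  likewise with \<open>a\<close> and \<open>b\<close> exchanged. If both failed, one violated
  inequality from each side would contradict an acute angle or the positivity of
  \<open>a \<bullet> (a + b)\<close>, \<open>b \<bullet> (a + b)\<close> or
  \<open>(a + b) \<bullet> (a + b)\<close>.\<close>

lemma acute_triangle_split:
  fixes a b y z :: "'a::real_inner"
  assumes sum: "a + b + y + z = 0" and nz: "a \<noteq> 0" "b \<noteq> 0" and obt: "a \<bullet> b \<ge> 0"
    and acute: "(a + b) \<bullet> y < 0" "(a + b) \<bullet> z < 0" "y \<bullet> z < 0"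
  defines "n \<equiv> triangle_size (a + b) y z"
  shows "triangle_size a (y + b) z < n \<and> triangle_size b y (- (y + b)) < n \<or>
         triangle_size b (y + a) z < n \<and> triangle_size a y (- (y + a)) < n"
proof -
  have z: "z = - (a + b + y)" using sum by (metis add_eq_0_iff)
  \<comment> \<open>In an acute triangle the sum of squares is the larger of the two terms in
    \<open>triangle_size\<close>.\<close>
  define m where "m = (a + b) \<bullet> (a + b) + y \<bullet> y + z \<bullet> z"
  have pos: "a \<bullet> a > 0" "b \<bullet> b > 0" using nz by auto
  have "triangle_size a (y + b) z < m \<and> triangle_size b y (- (y + b)) < m \<or>
         triangle_size b (y + a) z < m \<and> triangle_size a y (- (y + a)) < m"
    using pos obt acute unfolding m_def triangle_size_less_iff z
    by (simp add: inner_add inner_diff inner_commute del: inner_gt_zero_iff) argo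
  moreover have "m \<le> n" unfolding m_def n_def by (rule le_triangle_size)
  ultimately show ?thesis by linarith
qed

subsection \<open>Facet vectors\<close>

lemma euclidean_lattice_zero:
  assumes "euclidean_lattice \<Lambda>" shows "0 \<in> \<Lambda>"
proof -
  obtain B where B: "\<Lambda> = {\<Sum>b\<in>B. of_int (c b) *\<^sub>R b | c. True}"
    using assms unfolding euclidean_lattice_def by blast
  show ?thesis unfolding B by (intro CollectI exI[of _ "\<lambda>_. 0"]) simp
qed

lemma euclidean_lattice_diff:
  assumes "euclidean_lattice \<Lambda>" "x \<in> \<Lambda>" "y \<in> \<Lambda>" shows "x - y \<in> \<Lambda>"
proof -
  obtain B where B: "\<Lambda> = {\<Sum>b\<in>B. of_int (c b) *\<^sub>R b | c. True}"
    using assms unfolding euclidean_lattice_def by blast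
  obtain c d where "x = (\<Sum>b\<in>B. of_int (c b) *\<^sub>R b)" "y = (\<Sum>b\<in>B. of_int (d b) *\<^sub>R b)"
    using assms unfolding B by blast
  then show ?thesis unfolding B
    by (intro CollectI exI[of _ "\<lambda>b. c b - d b"])
      (simp add: scaleR_left_diff_distrib sum_subtractf)
qed

lemma euclidean_lattice_minus:
  assumes "euclidean_lattice \<Lambda>" "x \<in> \<Lambda>" shows "- x \<in> \<Lambda>"
  using euclidean_lattice_diff[OF assms(1) euclidean_lattice_zero assms(2)] assms(1) by simp

lemma euclidean_lattice_minus_iff:
  assumes "euclidean_lattice \<Lambda>" shows "- x \<in> \<Lambda> \<longleftrightarrow> x \<in> \<Lambda>"
  using euclidean_lattice_minus[OF assms] by (metis minus_minus)

lemma euclidean_lattice_add: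
  assumes "euclidean_lattice \<Lambda>" "x \<in> \<Lambda>" "y \<in> \<Lambda>" shows "x + y \<in> \<Lambda>"
  using euclidean_lattice_diff[OF assms(1,2) euclidean_lattice_minus[OF assms(1,3)]] by simp

lemma euclidean_lattice_basis:
  fixes \<Lambda> :: "'a::euclidean_space set"
  assumes "euclidean_lattice \<Lambda>"
  obtains B where "finite B" "independent B"
    "\<Lambda> = range (\<lambda>c. \<Sum>b\<in>B. real_of_int (c b) *\<^sub>R b)"
proof -
  from assms have "\<exists>B. finite B \<and> independent B \<and> \<Lambda> = range (\<lambda>c. \<Sum>b\<in>B. real_of_int (c b) *\<^sub>R b)"
    unfolding euclidean_lattice_def by (simp add: full_SetCompr_eq)
  then show thesis using that by blast
qed

text \<open>Each coordinate with respect to the basis extends to a linear, hence bounded,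
  functional. A bound on the norm therefore bounds the integer coefficients.\<close>

lemma finite_euclidean_lattice_norm_le:
  fixes \<Lambda> :: "'a::euclidean_space set"
  assumes "euclidean_lattice \<Lambda>"
  shows "finite {v \<in> \<Lambda>. norm v \<le> R}"
proof -
  define comb where "comb B c = (\<Sum>b\<in>B. real_of_int (c b) *\<^sub>R b)" for B :: "'a set" and c
  obtain B where B: "finite B" "independent B" "\<Lambda> = range (comb B)"
    using assms unfolding comb_def[abs_def] by (rule euclidean_lattice_basis)
  have "\<exists>K. \<forall>c. norm (comb B c) \<le> R \<longrightarrow> \<bar>c b\<bar> \<le> K" if "b \<in> B" for b
  proof -
    obtain f :: "'a \<Rightarrow> real" where f: "linear f" "\<forall>x\<in>B. f x = (if x = b then 1 else 0)"
      using linear_independent_extend[OF B(2), of "\<lambda>x. if x = b then 1 else 0"] by auto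
    obtain k where k: "\<And>x. norm (f x) \<le> norm x * k" "k > 0"
      using linear_bounded_pos[OF f(1)] by (auto simp: mult.commute)
    have "\<bar>c b\<bar> \<le> \<lceil>R * k\<rceil>" if "norm (comb B c) \<le> R" for c
    proof -
      have "f (comb B c) = (\<Sum>x\<in>B. of_int (c x) * f x)"
        by (simp add: comb_def linear_sum[OF f(1)] linear_scale[OF f(1)])
      also have "\<dots> = (\<Sum>x\<in>B. if x = b then of_int (c x) else 0)"
        using f(2) by (intro sum.cong) auto
      also have "\<dots> = of_int (c b)" using B(1) \<open>b \<in> B\<close> by simp
      finally have "norm (of_int (c b) :: real) \<le> norm (comb B c) * k"
        using k(1) by metis
      also have "\<dots> \<le> R * k" using that k(2) by (simp add: mult_right_mono)
      finally show ?thesis by (simp add: le_ceiling_iff)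
    qed
    then show ?thesis by blast
  qed
  then obtain K where K: "\<And>b c. b \<in> B \<Longrightarrow> norm (comb B c) \<le> R \<Longrightarrow> \<bar>c b\<bar> \<le> K b"
    by metis
  have "{v \<in> \<Lambda>. norm v \<le> R} \<subseteq> comb B ` (\<Pi>\<^sub>E b\<in>B. {- K b..K b})"
  proof
    fix v assume "v \<in> {v \<in> \<Lambda>. norm v \<le> R}"
    then obtain c where c: "v = comb B c" "norm v \<le> R" unfolding B(3) by blast
    \<comment> \<open>Coefficients outside \<open>B\<close> are arbitrary and have to be fixed
      before finitely many functions remain.\<close>
    have "restrict c B \<in> (\<Pi>\<^sub>E b\<in>B. {- K b..K b})"
      using K[of _ c] c by (auto simp: abs_le_iff minus_le_iff)
    moreover have "v = comb B (restrict c B)" using c by (simp add: comb_def)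
    ultimately show "v \<in> comb B ` (\<Pi>\<^sub>E b\<in>B. {- K b..K b})" by blast
  qed
  moreover have "finite (\<Pi>\<^sub>E b\<in>B. {- K b..K b})" using B(1) by (intro finite_PiE) auto
  ultimately show ?thesis by (meson finite_imageI finite_subset)
qed
lemma finite_euclidean_lattice_inner_le:
  assumes "euclidean_lattice \<Lambda>"
  shows "finite {v \<in> \<Lambda>. v \<bullet> v \<le> M}"
proof (rule finite_subset[OF _ finite_euclidean_lattice_norm_le[OF assms]])
  show "{v \<in> \<Lambda>. v \<bullet> v \<le> M} \<subseteq> {v \<in> \<Lambda>. norm v \<le> sqrt M}"
    by (auto simp: norm_eq_sqrt_inner)
qed

section \<open>Indecomposable vectors and the facets of the Voronoi cell\<close>

definition indecomposable :: "'a::real_inner set \<Rightarrow> 'a \<Rightarrow> bool" where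
  "indecomposable \<Lambda> f \<longleftrightarrow>
     f \<in> \<Lambda> \<and> f \<noteq> 0 \<and> \<not> (\<exists>x\<in>\<Lambda>. \<exists>y\<in>\<Lambda>. x \<noteq> 0 \<and> y \<noteq> 0 \<and> f = x + y \<and> x \<bullet> y \<ge> 0)"

lemma indecomposable_minus_iff:
  assumes "euclidean_lattice \<Lambda>"
  shows "indecomposable \<Lambda> (- f) \<longleftrightarrow> indecomposable \<Lambda> f"
proof -
  have "indecomposable \<Lambda> f" if f: "indecomposable \<Lambda> (- f)" for f
    unfolding indecomposable_def
  proof (intro conjI notI)
    show "f \<in> \<Lambda>" using f euclidean_lattice_minus_iff[OF assms] by (auto simp: indecomposable_def)
    show "f = 0 \<Longrightarrow> False" using f by (simp add: indecomposable_def)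
    assume "\<exists>x\<in>\<Lambda>. \<exists>y\<in>\<Lambda>. x \<noteq> 0 \<and> y \<noteq> 0 \<and> f = x + y \<and> x \<bullet> y \<ge> 0"
    then obtain x y where "x \<in> \<Lambda>" "y \<in> \<Lambda>" "x \<noteq> 0" "y \<noteq> 0" "f = x + y" "x \<bullet> y \<ge> 0" by blast
    then have "- x \<in> \<Lambda>" "- y \<in> \<Lambda>" "- x \<noteq> 0" "- y \<noteq> 0" "- f = - x + - y" "- x \<bullet> - y \<ge> 0"
      using euclidean_lattice_minus[OF assms] by auto
    with f show False unfolding indecomposable_def by blast
  qed
  from this[of f] this[of "- f"] show ?thesis by auto
qed

text \<open>For \<open>y = f - x\<close> the condition \<open>x \<bullet> y \<ge> 0\<close> reads
  \<open>x \<bullet> x \<le> f \<bullet> x\<close>. Geometrically, half of \<open>f\<close>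
  satisfies strictly every Voronoi inequality except those of 0 and \<open>f\<close>. Strictness
  reflects that orthogonal summands count as a decomposition.\<close>

lemma indecomposable_iff_inner_less:
  assumes "euclidean_lattice \<Lambda>"
  shows "indecomposable \<Lambda> f \<longleftrightarrow> f \<in> \<Lambda> \<and> f \<noteq> 0 \<and> (\<forall>x\<in>\<Lambda> - {0, f}. f \<bullet> x < x \<bullet> x)"
proof (cases "f \<in> \<Lambda>")
  case True
  have "(\<exists>x\<in>\<Lambda>. \<exists>y\<in>\<Lambda>. x \<noteq> 0 \<and> y \<noteq> 0 \<and> f = x + y \<and> x \<bullet> y \<ge> 0) \<longleftrightarrow>
        \<not> (\<forall>x\<in>\<Lambda> - {0, f}. f \<bullet> x < x \<bullet> x)" (is "?L \<longleftrightarrow> ?R")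
  proof
    assume ?L
    then obtain x y where "x \<in> \<Lambda>" "y \<in> \<Lambda>" "x \<noteq> 0" "y \<noteq> 0" "f = x + y" "x \<bullet> y \<ge> 0" by blast
    then have "x \<in> \<Lambda> - {0, f}" "\<not> f \<bullet> x < x \<bullet> x" by (auto simp: inner_add inner_commute)
    then show ?R by blast
  next
    assume ?R
    then obtain x where x: "x \<in> \<Lambda>" "x \<noteq> 0" "x \<noteq> f" "x \<bullet> x \<le> f \<bullet> x"
      by (auto simp: not_less)
    have "f - x \<in> \<Lambda>" using True x(1) euclidean_lattice_diff[OF assms] by blast
    then show ?L using x
      by (intro bexI[of _ x] bexI[of _ "f - x"]) (auto simp: inner_diff inner_commute)
  qed
  then show ?thesis unfolding indecomposable_def using True by simp
qed (simp add: indecomposable_def)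

text \<open>Only finitely many of the inequalities that define the Voronoi cell matter near a point.\<close>

lemma strict_voronoi_inequalities_open:
  assumes "euclidean_lattice \<Lambda>" and p: "\<forall>g\<in>\<Lambda> - A. p \<bullet> g < (g \<bullet> g) / 2"
  obtains T where "open T" "p \<in> T" "\<And>x g. x \<in> T \<Longrightarrow> g \<in> \<Lambda> - A \<Longrightarrow> x \<bullet> g < (g \<bullet> g) / 2"
proof
  define R where "R = norm p + 1"
  \<comment> \<open>For \<open>norm x < R\<close> and \<open>norm g > 2 * R\<close>, Cauchy-Schwarz
    already gives the inequality of \<open>g\<close>.\<close>
  define N where "N = {g \<in> \<Lambda>. norm g \<le> 2 * R} - A"
  define T where "T = ball 0 R \<inter> (\<Inter>g\<in>N. {x. g \<bullet> x < (g \<bullet> g) / 2})"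
  have "finite N" unfolding N_def
    using finite_euclidean_lattice_norm_le[OF assms(1)] by blast
  then show "open T" unfolding T_def
    by (intro open_Int open_INT open_ball ballI open_halfspace_lt)
  show "p \<in> T" using p unfolding T_def N_def R_def by (auto simp: inner_commute)
  show "x \<bullet> g < (g \<bullet> g) / 2" if x: "x \<in> T" and g: "g \<in> \<Lambda> - A" for x g
  proof (cases "norm g \<le> 2 * R")
    case True
    then have "g \<in> N" using g by (simp add: N_def)
    then show ?thesis using x by (auto simp: T_def inner_commute)
  next
    case False
    have "R > 0" unfolding R_def by (simp add: add_nonneg_pos)
    then have "norm g > 0" using False by linarith
    have "x \<bullet> g \<le> norm x * norm g" by (rule norm_cauchy_schwarz)
    also have "\<dots> < (norm g / 2) * norm g"
      using x False \<open>norm g > 0\<close> by (intro mult_strict_right_mono) (auto simp: T_def)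
    also have "\<dots> = (g \<bullet> g) / 2" by (simp add: dot_square_norm power2_eq_square)
    finally show ?thesis .
  qed
qed

lemma convex_voronoi_cell: "convex (voronoi_cell \<Lambda>)"
proof -
  have "voronoi_cell \<Lambda> = span \<Lambda> \<inter> (\<Inter>g\<in>\<Lambda>. {x. g \<bullet> x \<le> (g \<bullet> g) / 2})"
    unfolding voronoi_cell_def by (auto simp: inner_commute)
  then show ?thesis
    by (simp only:) (intro convex_Int convex_INT subspace_imp_convex[OF subspace_span] convex_halfspace_le)
qed

text \<open>At the origin all inequalities with \<open>g \<noteq> 0\<close> are strict, so the cell
  contains a neighbourhood of 0 in the span.\<close>

lemma aff_dim_voronoi_cell:
  assumes "euclidean_lattice \<Lambda>"
  shows "aff_dim (voronoi_cell \<Lambda>) = aff_dim (span \<Lambda>)"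
proof (rule antisym)
  show "aff_dim (voronoi_cell \<Lambda>) \<le> aff_dim (span \<Lambda>)"
    by (rule aff_dim_subset) (auto simp: voronoi_cell_def)
  have "\<forall>g\<in>\<Lambda> - {0}. 0 \<bullet> g < (g \<bullet> g) / 2" by simp
  then obtain T where T: "open T" "0 \<in> T"
    "\<And>x g. x \<in> T \<Longrightarrow> g \<in> \<Lambda> - {0} \<Longrightarrow> x \<bullet> g < (g \<bullet> g) / 2"
    by (rule strict_voronoi_inequalities_open[OF assms]) (rule that)
  have "span \<Lambda> \<inter> T \<subseteq> voronoi_cell \<Lambda>"
    using T(3) unfolding voronoi_cell_def by (fastforce intro: less_imp_le)
  moreover have "aff_dim (span \<Lambda> \<inter> T) = aff_dim (span \<Lambda>)"
    using T(1,2) span_zero[of \<Lambda>]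
    by (intro aff_dim_convex_Int_open subspace_imp_convex subspace_span) auto
  ultimately show "aff_dim (span \<Lambda>) \<le> aff_dim (voronoi_cell \<Lambda>)"
    using aff_dim_subset by metis
qed

text \<open>The hyperplane meets the span in half of \<open>f\<close> but misses 0, so it cuts the
  dimension by exactly one.\<close>

lemma aff_dim_span_Int_hyperplane:
  fixes f :: "'a::euclidean_space"
  assumes "f \<in> span \<Lambda>" "f \<noteq> 0"
  shows "aff_dim (span \<Lambda> \<inter> {x. f \<bullet> x = (f \<bullet> f) / 2}) = aff_dim (span \<Lambda>) - 1"
proof -
  have "(1/2) *\<^sub>R f \<in> span \<Lambda> \<inter> {x. f \<bullet> x = (f \<bullet> f) / 2}" using assms by (simp add: span_scale)
  moreover have "0 \<in> span \<Lambda>" "f \<bullet> 0 \<noteq> (f \<bullet> f) / 2" using assms by (auto simp: span_zero)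
  ultimately show ?thesis
    by (subst aff_dim_affine_Int_hyperplane) (auto simp: subspace_imp_affine)
qed

text \<open>If \<open>f = x + y\<close> with \<open>x \<bullet> y \<ge> 0\<close>, a facet on the
  hyperplane of \<open>f\<close> lies on those of \<open>x\<close> and \<open>y\<close> too, which
  leaves one dimension too few. If \<open>f\<close> is indecomposable, a neighbourhood of half of
  \<open>f\<close> in its hyperplane belongs to the cell.\<close>

lemma facet_vector_iff_indecomposable:
  assumes \<Lambda>: "euclidean_lattice \<Lambda>"
  shows "facet_vector \<Lambda> f \<longleftrightarrow> indecomposable \<Lambda> f"
proof
  assume "facet_vector \<Lambda> f"
  then obtain G where f: "f \<in> \<Lambda>" "f \<noteq> 0" and G: "G facet_of voronoi_cell \<Lambda>"
    "G \<subseteq> {x \<in> span \<Lambda>. x \<bullet> f = (f \<bullet> f) / 2}"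
    unfolding facet_vector_def by blast
  show "indecomposable \<Lambda> f"
    unfolding indecomposable_def
  proof (intro conjI f notI)
    assume "\<exists>x\<in>\<Lambda>. \<exists>y\<in>\<Lambda>. x \<noteq> 0 \<and> y \<noteq> 0 \<and> f = x + y \<and> x \<bullet> y \<ge> 0"
    then obtain x y where xy: "x \<in> \<Lambda>" "y \<in> \<Lambda>" "x \<noteq> 0" "y \<noteq> 0" "f = x + y" "x \<bullet> y \<ge> 0" by blast
    define A where "A = span \<Lambda> \<inter> {p. x \<bullet> p = (x \<bullet> x) / 2}"
    \<comment> \<open>The inequalities of \<open>x\<close> and \<open>y\<close> bound
      \<open>p \<bullet> f\<close> by \<open>(x \<bullet> x + y \<bullet> y) / 2\<close>, which is
      at most \<open>(f \<bullet> f) / 2\<close>. As \<open>p\<close> attains the latter, all of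
      these are equalities.\<close>
    have on: "p \<in> A \<and> y \<bullet> p = (y \<bullet> y) / 2 \<and> x \<bullet> y = 0" if "p \<in> G" for p
    proof -
      have p: "p \<in> span \<Lambda>" "p \<bullet> x + p \<bullet> y = (f \<bullet> f) / 2"
        using that G(2) xy(5) by (auto simp: inner_add_right)
      have "p \<bullet> x \<le> (x \<bullet> x) / 2" "p \<bullet> y \<le> (y \<bullet> y) / 2"
        using that facet_of_imp_subset[OF G(1)] xy(1,2) unfolding voronoi_cell_def by auto
      moreover have "f \<bullet> f = x \<bullet> x + y \<bullet> y + 2 * (x \<bullet> y)"
        using xy(5) by (simp add: inner_add inner_commute)
      ultimately show ?thesis
        using p xy(6) unfolding A_def by (simp add: inner_commute[of _ p])
    qed
    have GA: "G \<subseteq> A \<inter> {p. y \<bullet> p = (y \<bullet> y) / 2}" using on by blast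
    have ne: "G \<noteq> {}" using G(1) by (simp add: facet_of_def)
    then have "x \<bullet> y = 0" using on by blast
    \<comment> \<open>By orthogonality this point of \<open>A\<close> is off the hyperplane of
      \<open>y\<close>, so intersecting with that hyperplane lowers the dimension once more.\<close>
    have "(1/2) *\<^sub>R x \<in> A" using xy(1) by (simp add: A_def span_base span_scale)
    moreover have "(1/2) *\<^sub>R x \<notin> {p. y \<bullet> p = (y \<bullet> y) / 2}"
      using \<open>x \<bullet> y = 0\<close> xy(4) by (simp add: inner_commute)
    moreover have "affine A" unfolding A_def
      by (intro affine_Int subspace_imp_affine affine_hyperplane) simp
    ultimately have "aff_dim (A \<inter> {p. y \<bullet> p = (y \<bullet> y) / 2}) = aff_dim A - 1"
      using GA ne by (subst aff_dim_affine_Int_hyperplane) auto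
    moreover have "aff_dim A = aff_dim (span \<Lambda>) - 1" unfolding A_def
      using xy by (intro aff_dim_span_Int_hyperplane) (auto simp: span_base)
    moreover have "aff_dim G = aff_dim (span \<Lambda>) - 1"
      using G(1) aff_dim_voronoi_cell[OF \<Lambda>] by (simp add: facet_of_def)
    ultimately show False using aff_dim_subset[OF GA] by linarith
  qed
next
  assume "indecomposable \<Lambda> f"
  then have f: "f \<in> \<Lambda>" "f \<noteq> 0" "\<And>x. x \<in> \<Lambda> - {0, f} \<Longrightarrow> f \<bullet> x < x \<bullet> x"
    unfolding indecomposable_iff_inner_less[OF \<Lambda>] by auto
  define H where "H = {x. f \<bullet> x = (f \<bullet> f) / 2}"
  define G where "G = voronoi_cell \<Lambda> \<inter> H"
  have "\<forall>g\<in>\<Lambda> - {0, f}. (1/2) *\<^sub>R f \<bullet> g < (g \<bullet> g) / 2" using f(3) by fastforce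
  then obtain T where T: "open T" "(1/2) *\<^sub>R f \<in> T"
    "\<And>x g. x \<in> T \<Longrightarrow> g \<in> \<Lambda> - {0, f} \<Longrightarrow> x \<bullet> g < (g \<bullet> g) / 2"
    by (rule strict_voronoi_inequalities_open[OF \<Lambda>]) (rule that)
  have half: "(1/2) *\<^sub>R f \<in> span \<Lambda> \<inter> H" using f(1) by (simp add: H_def span_base span_scale)
  have sub: "(span \<Lambda> \<inter> H) \<inter> T \<subseteq> G"
  proof
    fix x assume x: "x \<in> (span \<Lambda> \<inter> H) \<inter> T"
    have "x \<bullet> g \<le> (g \<bullet> g) / 2" if "g \<in> \<Lambda>" for g
      using x T(3)[of x g] that by (cases "g = 0 \<or> g = f") (auto simp: H_def inner_commute)
    then show "x \<in> G" using x by (simp add: G_def voronoi_cell_def)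
  qed
  have "aff_dim ((span \<Lambda> \<inter> H) \<inter> T) = aff_dim (span \<Lambda> \<inter> H)"
    using half T(1,2) unfolding H_def
    by (intro aff_dim_convex_Int_open convex_Int convex_hyperplane subspace_imp_convex) auto
  then have "aff_dim (span \<Lambda> \<inter> H) \<le> aff_dim G" using aff_dim_subset[OF sub] by simp
  moreover have "aff_dim G \<le> aff_dim (span \<Lambda> \<inter> H)"
    by (rule aff_dim_subset) (auto simp: G_def voronoi_cell_def)
  moreover have "aff_dim (span \<Lambda> \<inter> H) = aff_dim (voronoi_cell \<Lambda>) - 1"
    unfolding aff_dim_voronoi_cell[OF \<Lambda>] H_def
    using f by (intro aff_dim_span_Int_hyperplane) (auto simp: span_base)
  ultimately have "aff_dim G = aff_dim (voronoi_cell \<Lambda>) - 1" by simp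
  moreover have "G face_of voronoi_cell \<Lambda>" unfolding G_def H_def
    by (rule face_of_Int_supporting_hyperplane_le[OF convex_voronoi_cell])
      (use f(1) in \<open>auto simp: voronoi_cell_def inner_commute\<close>)
  moreover have "G \<noteq> {}" using half T(2) sub by blast
  ultimately have "G facet_of voronoi_cell \<Lambda>" by (simp add: facet_of_def)
  moreover have "G \<subseteq> {x \<in> span \<Lambda>. x \<bullet> f = (f \<bullet> f) / 2}"
    by (auto simp: G_def H_def voronoi_cell_def inner_commute)
  ultimately show "facet_vector \<Lambda> f" using f unfolding facet_vector_def by blast
qed

subsection \<open>Decompositions into facet vectors\<close>

lemma keys_subset_add:
  "Poly_Mapping.keys a \<subseteq> S \<Longrightarrow> Poly_Mapping.keys b \<subseteq> S \<Longrightarrow> Poly_Mapping.keys (a + b) \<subseteq> S"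
  using keys_add[of a b] by blast

lemma keys_subset_diff:
  "Poly_Mapping.keys a \<subseteq> S \<Longrightarrow> Poly_Mapping.keys b \<subseteq> S \<Longrightarrow> Poly_Mapping.keys (a - b) \<subseteq> S"
  using keys_diff[of a b] by blast

lemma frag_eval_superset:
  assumes "finite S" "Poly_Mapping.keys z \<subseteq> S"
  shows "frag_eval z = (\<Sum>f\<in>S. of_int (Poly_Mapping.lookup z f) *\<^sub>R f)"
  unfolding frag_eval_def using assms by (intro sum.mono_neutral_left) (auto simp: in_keys_iff)

lemma frag_eval_0 [simp]: "frag_eval 0 = 0"
  by (simp add: frag_eval_def)

lemma frag_eval_add: "frag_eval (a + b) = frag_eval a + frag_eval b"
proof -
  let ?S = "Poly_Mapping.keys a \<union> Poly_Mapping.keys b"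
  have S: "finite ?S" "Poly_Mapping.keys (a + b) \<subseteq> ?S" using keys_add[of a b] by auto
  show ?thesis
    unfolding frag_eval_superset[OF S] frag_eval_superset[OF S(1) Un_upper1]
      frag_eval_superset[OF S(1) Un_upper2]
    by (simp add: lookup_add scaleR_left_distrib sum.distrib)
qed

lemma frag_eval_minus: "frag_eval (- a) = - frag_eval a"
  using frag_eval_add[of a "- a"] by (simp add: eq_neg_iff_add_eq_0 add.commute)

lemma frag_eval_diff: "frag_eval (a - b) = frag_eval a - frag_eval b"
  using frag_eval_add[of a "- b"] by (simp add: frag_eval_minus)

lemma frag_eval_frag_of [simp]: "frag_eval (frag_of f) = f"
  by (simp add: frag_eval_def)

lemma group_lattice_group:
  assumes "euclidean_lattice \<Lambda>" shows "group (lattice_group \<Lambda>)"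
proof (rule groupI)
  fix x assume "x \<in> carrier (lattice_group \<Lambda>)"
  then show "\<exists>y\<in>carrier (lattice_group \<Lambda>). y \<otimes>\<^bsub>lattice_group \<Lambda>\<^esub> x = \<one>\<^bsub>lattice_group \<Lambda>\<^esub>"
    using euclidean_lattice_minus[OF assms]
    by (intro bexI[of _ "- x"]) (auto simp: lattice_group_def)
qed (use assms in \<open>auto simp: lattice_group_def add.assoc
      intro: euclidean_lattice_zero euclidean_lattice_add\<close>)

section \<open>Signed facet vectors and decompositions\<close>

lemma add_nonzero_of_inner_nonneg:
  fixes x y :: "'a::real_inner"
  assumes "x \<noteq> 0" "x \<bullet> y \<ge> 0" shows "x + y \<noteq> 0"
proof
  assume "x + y = 0"
  then have "y = - x" by (simp add: eq_neg_iff_add_eq_0 add.commute)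
  with assms(2) have "x \<bullet> x \<le> 0" by simp
  with assms(1) show False by (metis inner_gt_zero_iff not_le)
qed

text \<open>Meant for indecomposable \<open>v\<close>, where exactly one of \<open>v\<close> and
  \<open>- v\<close> lies in \<open>F\<close>; elsewhere the second branch is only a
  default.\<close>

definition signed_frag_of :: "'a::group_add set \<Rightarrow> 'a \<Rightarrow> 'a \<Rightarrow>\<^sub>0 int" where
  "signed_frag_of F v = (if v \<in> F then frag_of v else - frag_of (- v))"

text \<open>
  A relation rather than a function: no choice of summands has to be made, and uniqueness modulo
  line relations becomes a statement about arbitrary derivations.
\<close>

inductive decomposition :: "'a::euclidean_space set \<Rightarrow> 'a set \<Rightarrow> 'a \<Rightarrow> ('a \<Rightarrow>\<^sub>0 int) \<Rightarrow> bool"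
  for \<Lambda> F where
  zero: "decomposition \<Lambda> F 0 0"
| indecomposable: "indecomposable \<Lambda> v \<Longrightarrow> decomposition \<Lambda> F v (signed_frag_of F v)"
| sum: "decomposition \<Lambda> F x a \<Longrightarrow> decomposition \<Lambda> F y b \<Longrightarrow> x \<noteq> 0 \<Longrightarrow> y \<noteq> 0 \<Longrightarrow> x \<bullet> y \<ge> 0 \<Longrightarrow>
    decomposition \<Lambda> F (x + y) (a + b)"

locale lattice_facet_reps =
  fixes \<Lambda> F :: "'a::euclidean_space set"
  assumes lattice: "euclidean_lattice \<Lambda>"
    and facet_reps: "opposite_pair_reps F {f. facet_vector \<Lambda> f}"
begin

lemmas lattice_closed [simp, intro] = euclidean_lattice_zero[OF lattice]
  euclidean_lattice_add[OF lattice] euclidean_lattice_diff[OF lattice]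
  euclidean_lattice_minus[OF lattice]

lemma F_indecomposable: "f \<in> F \<Longrightarrow> indecomposable \<Lambda> f"
  using facet_reps facet_vector_iff_indecomposable[OF lattice] unfolding opposite_pair_reps_def by auto

lemma minus_mem_F_iff:
  assumes "indecomposable \<Lambda> v" shows "- v \<in> F \<longleftrightarrow> v \<notin> F"
proof -
  \<comment> \<open>Otherwise \<open>{v, - v}\<close> would be a singleton, and \<open>v\<close> and
    \<open>- v\<close> could both lie in \<open>F\<close>.\<close>
  have "v \<noteq> - v" using assms eq_neg_iff_add_eq_0[of v v]
    by (auto simp: indecomposable_def simp flip: scaleR_2)
  moreover have "\<exists>!y. y \<in> F \<inter> {v, - v}"
    using facet_reps assms facet_vector_iff_indecomposable[OF lattice] unfolding opposite_pair_reps_def by auto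
  ultimately show ?thesis by auto
qed

lemma signed_frag_of_minus:
  assumes "indecomposable \<Lambda> v"
  shows "signed_frag_of F (- v) = - signed_frag_of F v"
  using minus_mem_F_iff[OF assms] by (auto simp: signed_frag_of_def)

lemma signed_frag_of_cases:
  assumes "indecomposable \<Lambda> v"
  obtains f e where "f \<in> F" "e \<in> {1, -1}" "v = of_int e *\<^sub>R f" "signed_frag_of F v = frag_cmul e (frag_of f)"
proof (cases "v \<in> F")
  case True
  then show ?thesis using that[of v 1] by (simp add: signed_frag_of_def)
next
  case False
  then show ?thesis using that[of "- v" "-1"] minus_mem_F_iff[OF assms]
    by (simp add: signed_frag_of_def)
qed

lemma not_indecomposable_sum:
  assumes "x \<in> \<Lambda>" "y \<in> \<Lambda>" "x \<noteq> 0" "y \<noteq> 0" "x \<bullet> y \<ge> 0"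
  shows "\<not> indecomposable \<Lambda> (x + y)"
  using assms unfolding indecomposable_def by blast

lemma decomposition_sound:
  assumes "decomposition \<Lambda> F v e"
  shows "v \<in> \<Lambda>" "Poly_Mapping.keys e \<subseteq> F" "frag_eval e = v"
  using assms
proof (induction)
  case (indecomposable v)
  case 1 then show ?case using indecomposable by (simp add: indecomposable_def)
  case 2 then show ?case using minus_mem_F_iff[OF indecomposable]
    by (simp add: signed_frag_of_def)
  case 3 then show ?case by (simp add: signed_frag_of_def frag_eval_minus)
qed (simp_all add: frag_eval_add keys_subset_add)

lemma decomposition_exists: "v \<in> \<Lambda> \<Longrightarrow> \<exists>e. decomposition \<Lambda> F v e"
proof (induction v rule: real_measure_induct[where S = \<Lambda> and m = "\<lambda>v. v \<bullet> v"])
  case (finite M)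
  show ?case by (rule finite_euclidean_lattice_inner_le[OF lattice])
next
  case (step v)
  consider "v = 0" | "indecomposable \<Lambda> v"
    | x y where "x \<in> \<Lambda>" "y \<in> \<Lambda>" "x \<noteq> 0" "y \<noteq> 0" "v = x + y" "x \<bullet> y \<ge> 0"
    using step(1) unfolding indecomposable_def by blast
  then show ?case
  proof cases
    case 3
    then have "x \<bullet> x > 0" "y \<bullet> y > 0" "v \<bullet> v = x \<bullet> x + y \<bullet> y + 2 * (x \<bullet> y)"
      by (auto simp: inner_add inner_commute)
    then have "x \<bullet> x < v \<bullet> v" "y \<bullet> y < v \<bullet> v" using 3(6) by linarith+
    then obtain a b where "decomposition \<Lambda> F x a" "decomposition \<Lambda> F y b"
      using step(2) 3(1,2) by blast
    then show ?thesis using 3 decomposition.sum by blast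
  qed (auto intro: decomposition.zero decomposition.indecomposable)
qed

text \<open>Nonzero vectors with nonnegative inner product never cancel, so rule \<open>sum\<close>
  cannot produce 0.\<close>

lemma decomposition_zero: "decomposition \<Lambda> F 0 e \<Longrightarrow> e = 0"
  by (cases rule: decomposition.cases)
    (auto simp: indecomposable_def dest: add_nonzero_of_inner_nonneg)

lemma decomposition_indecomposable:
  assumes "indecomposable \<Lambda> v" "decomposition \<Lambda> F v e"
  shows "e = signed_frag_of F v"
  using assms(2)
proof (cases rule: decomposition.cases)
  case (sum x a y b)
  then show ?thesis
    using assms(1) not_indecomposable_sum[of x y] decomposition_sound(1) by blast
qed (use assms(1) in \<open>auto simp: indecomposable_def\<close>)

text \<open>This allows a side shared by two triangles to be traversed in opposite
  directions.\<close>

lemma decomposition_minus: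
  "decomposition \<Lambda> F v e \<Longrightarrow> decomposition \<Lambda> F (- v) (- e)"
proof (induction rule: decomposition.induct)
  case (indecomposable v)
  then show ?case using signed_frag_of_minus decomposition.indecomposable[of \<Lambda> "- v" F]
      indecomposable_minus_iff[OF lattice] by simp
next
  case (sum x a y b)
  then show ?case using decomposition.sum[OF sum.IH] by simp
qed (simp add: decomposition.zero)

text \<open>All line relations are taken, so that no choice of signs interferes;
  \<open>generate_opposite_pair_reps\<close> passes to representatives at the end.\<close>

definition relations :: "('a \<Rightarrow>\<^sub>0 int) set" where
  "relations = generate (free_Abelian_group F) (line_relations \<Lambda> F)"

lemma line_relations_subset: "line_relations \<Lambda> F \<subseteq> carrier (free_Abelian_group F)"
  unfolding line_relations_def kernel_def by blast

lemma subgroup_relations: "subgroup relations (free_Abelian_group F)"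
  unfolding relations_def
  by (rule group.generate_is_subgroup[OF group_free_Abelian_group line_relations_subset])

lemma relations_keys: assumes "a \<in> relations" shows "Poly_Mapping.keys a \<subseteq> F"
  using subsetD[OF subgroup.subset[OF subgroup_relations] assms] by simp

lemma relations_zero: "0 \<in> relations"
  using subgroup.one_closed[OF subgroup_relations] by simp

lemma relations_add: "a \<in> relations \<Longrightarrow> b \<in> relations \<Longrightarrow> a + b \<in> relations"
  using subgroup.m_closed[OF subgroup_relations] by simp

lemma relations_minus: "a \<in> relations \<Longrightarrow> - a \<in> relations"
  using subgroup.m_inv_closed[OF subgroup_relations] relations_keys by simp

lemma relations_diff: "a \<in> relations \<Longrightarrow> b \<in> relations \<Longrightarrow> a - b \<in> relations"
  using relations_add relations_minus by fastforce

subsection \<open>Additivity modulo line relations\<close>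

text \<open>Quantifying over all decompositions makes independence of choices a special case: it is
  the triangle \<open>x\<close>, \<open>- x\<close>, 0.\<close>

definition consistent :: "'a \<Rightarrow> 'a \<Rightarrow> 'a \<Rightarrow> bool" where
  "consistent x y z \<longleftrightarrow> (\<forall>a b c. decomposition \<Lambda> F x a \<longrightarrow> decomposition \<Lambda> F y b \<longrightarrow>
     decomposition \<Lambda> F z c \<longrightarrow> a + b + c \<in> relations)"

lemma consistentD:
  "consistent x y z \<Longrightarrow> decomposition \<Lambda> F x a \<Longrightarrow> decomposition \<Lambda> F y b \<Longrightarrow>
    decomposition \<Lambda> F z c \<Longrightarrow> a + b + c \<in> relations"
  by (simp add: consistent_def)

lemma consistent_commute12:
  assumes "consistent x y z" shows "consistent y x z"
  unfolding consistent_def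
proof (intro allI impI)
  fix a b c
  assume d: "decomposition \<Lambda> F y a" "decomposition \<Lambda> F x b" "decomposition \<Lambda> F z c"
  from consistentD[OF assms d(2,1,3)] show "a + b + c \<in> relations" by (simp only: add_ac)
qed

lemma consistent_commute23:
  assumes "consistent x y z" shows "consistent x z y"
  unfolding consistent_def
proof (intro allI impI)
  fix a b c
  assume d: "decomposition \<Lambda> F x a" "decomposition \<Lambda> F z b" "decomposition \<Lambda> F y c"
  from consistentD[OF assms d(1,3,2)] show "a + b + c \<in> relations" by (simp only: add_ac)
qed

text \<open>The induction hypothesis on triangles, as a predicate that the separate cases can
  assume.\<close>

definition consistent_below :: "real \<Rightarrow> bool" where
  "consistent_below n \<longleftrightarrow> (\<forall>x\<in>\<Lambda>. \<forall>y\<in>\<Lambda>. \<forall>z\<in>\<Lambda>.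
     x + y + z = 0 \<longrightarrow> triangle_size x y z < n \<longrightarrow> consistent x y z)"

lemma consistent_belowD:
  "consistent_below n \<Longrightarrow> x \<in> \<Lambda> \<Longrightarrow> y \<in> \<Lambda> \<Longrightarrow> z \<in> \<Lambda> \<Longrightarrow> x + y + z = 0 \<Longrightarrow>
    triangle_size x y z < n \<Longrightarrow> consistent x y z"
  by (simp add: consistent_below_def)

text \<open>The two triangles share the side \<open>z - x\<close> up to sign. One decomposition
  \<open>e\<close> of it serves both and cancels in the sum.\<close>

lemma quadrilateral_consistent:
  assumes "consistent x (- z) (z - x)" "consistent y (- w) (w - y)" "x + y = z + w"
    and "decomposition \<Lambda> F x a" "decomposition \<Lambda> F y b"
      "decomposition \<Lambda> F z c" "decomposition \<Lambda> F w d"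
  shows "a + b - (c + d) \<in> relations"
proof -
  have "z - x \<in> \<Lambda>" using assms decomposition_sound(1) by blast
  then obtain e where e: "decomposition \<Lambda> F (z - x) e" using decomposition_exists by blast
  have "w - y = - (z - x)" using assms(3) by (simp add: algebra_simps)
  then have "decomposition \<Lambda> F (w - y) (- e)" using decomposition_minus[OF e] by simp
  then have "a + - c + e \<in> relations" "b + - d + - e \<in> relations"
    using consistentD[OF assms(1,4) decomposition_minus[OF assms(6)] e]
      consistentD[OF assms(2,5) decomposition_minus[OF assms(7)]] by blast+
  from relations_add[OF this] show ?thesis by (simp add: algebra_simps)
qed

text \<open>Compare the last steps \<open>v = x + y\<close> and \<open>v = z + w\<close> of the two
  derivations. The threshold is the bound in \<open>quadrilateral_split\<close>, so the linking
  triangles fall under the induction hypothesis.\<close>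

lemma decomposition_unique_mod_relations:
  assumes below: "consistent_below (2 * (v \<bullet> v))"
    and "decomposition \<Lambda> F v e" "decomposition \<Lambda> F v e'"
  shows "e - e' \<in> relations"
proof (cases "v = 0 \<or> indecomposable \<Lambda> v")
  case True
  then have "e = e'" using assms(2,3) decomposition_zero decomposition_indecomposable by metis
  then show ?thesis by (simp add: relations_zero)
next
  case False
  obtain x y a b where xy: "v = x + y" "e = a + b" "decomposition \<Lambda> F x a"
    "decomposition \<Lambda> F y b" "x \<noteq> 0" "y \<noteq> 0" "x \<bullet> y \<ge> 0"
    using assms(2) False by (cases rule: decomposition.cases) auto
  obtain z w c d where zw: "v = z + w" "e' = c + d" "decomposition \<Lambda> F z c"
    "decomposition \<Lambda> F w d" "z \<noteq> 0" "w \<noteq> 0" "z \<bullet> w \<ge> 0"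
    using assms(3) False by (cases rule: decomposition.cases) auto
  have mem: "x \<in> \<Lambda>" "y \<in> \<Lambda>" "z \<in> \<Lambda>" "w \<in> \<Lambda>"
    using xy zw decomposition_sound(1) by auto
  have sum: "x + y = z + w" using xy zw by simp
  from quadrilateral_split[OF sum xy(5,6) zw(5,6) xy(7) zw(7)]
  show ?thesis
  proof
    assume "triangle_size x (- z) (z - x) < 2 * ((x + y) \<bullet> (x + y)) \<and>
      triangle_size y (- w) (w - y) < 2 * ((x + y) \<bullet> (x + y))"
    then have "consistent x (- z) (z - x)" "consistent y (- w) (w - y)"
      using below mem xy(1) by (auto intro!: consistent_belowD)
    from quadrilateral_consistent[OF this sum xy(3,4) zw(3,4)]
    show ?thesis using xy(2) zw(2) by simp
  next
    assume "triangle_size x (- w) (w - x) < 2 * ((x + y) \<bullet> (x + y)) \<and>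
      triangle_size y (- z) (z - y) < 2 * ((x + y) \<bullet> (x + y))"
    then have "consistent x (- w) (w - x)" "consistent y (- z) (z - y)"
      using below mem xy(1) by (auto intro!: consistent_belowD)
    from quadrilateral_consistent[OF this _ xy(3,4) zw(4,3)]
    show ?thesis using xy(2) zw(2) sum by (simp add: add.commute)
  qed
qed

lemma consistent_below_mono: "consistent_below n \<Longrightarrow> m \<le> n \<Longrightarrow> consistent_below m"
  unfolding consistent_below_def by (meson less_le_trans)

text \<open>Both \<open>a + b\<close> and \<open>- c\<close> decompose the longest side
  \<open>x + y\<close>, so they agree modulo relations. The term \<open>2 * (z \<bullet> z)\<close>
  in \<open>triangle_size\<close> is what makes the induction hypothesis strong enough.\<close>

lemma consistent_obtuse:
  assumes below: "consistent_below (triangle_size x y z)"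
    and "x + y + z = 0" "x \<bullet> y \<ge> 0"
  shows "consistent x y z"
  unfolding consistent_def
proof (intro allI impI)
  fix a b c
  assume abc: "decomposition \<Lambda> F x a" "decomposition \<Lambda> F y b" "decomposition \<Lambda> F z c"
  have z: "z = - (x + y)" using assms(2) by (metis add_eq_0_iff)
  then have "- z = x + y" by simp
  then have c: "decomposition \<Lambda> F (x + y) (- c)" using decomposition_minus[OF abc(3)] by metis
  have "2 * ((x + y) \<bullet> (x + y)) = 2 * (z \<bullet> z)"
    unfolding z by (simp only: inner_minus_left inner_minus_right minus_minus)
  also have "\<dots> \<le> triangle_size x y z" by (rule le_triangle_size)
  finally have below': "consistent_below (2 * ((x + y) \<bullet> (x + y)))"
    using below consistent_below_mono by blast
  have "decomposition \<Lambda> F (x + y) (a + b)"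
  proof -
    \<comment> \<open>Rule \<open>sum\<close> demands nonzero summands; a vanishing side contributes
      0 to the formal sum.\<close>
    consider "x = 0" | "y = 0" | "x \<noteq> 0" "y \<noteq> 0" by blast
    then show ?thesis
      using abc decomposition_zero[of a] decomposition_zero[of b] decomposition.sum[OF abc(1,2)] assms(3)
      by cases auto
  qed
  from decomposition_unique_mod_relations[OF below' this c]
  show "a + b + c \<in> relations" by simp
qed

text \<open>The last step \<open>x = x1 + x2\<close> in the derivation of \<open>c\<close> cuts the
  triangle in two. Their common side \<open>y + x2\<close> or \<open>y + x1\<close> cancels when the
  two relations are added.\<close>

lemma consistent_acute_decomposable:
  assumes below: "consistent_below (triangle_size x y z)"
    and mem: "y \<in> \<Lambda>" "z \<in> \<Lambda>"
    and sum: "x + y + z = 0" and acute: "x \<bullet> y < 0" "x \<bullet> z < 0" "y \<bullet> z < 0"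
    and "\<not> indecomposable \<Lambda> x"
  shows "consistent x y z"
  unfolding consistent_def
proof (intro allI impI)
  fix c d e
  assume cde: "decomposition \<Lambda> F x c" "decomposition \<Lambda> F y d" "decomposition \<Lambda> F z e"
  have "x \<noteq> 0" using acute by auto
  from cde(1) obtain x1 x2 c1 c2 where x: "x = x1 + x2" "c = c1 + c2" "decomposition \<Lambda> F x1 c1"
    "decomposition \<Lambda> F x2 c2" "x1 \<noteq> 0" "x2 \<noteq> 0" "x1 \<bullet> x2 \<ge> 0"
    using assms(8) \<open>x \<noteq> 0\<close> by (cases rule: decomposition.cases) auto
  have mem': "x1 \<in> \<Lambda>" "x2 \<in> \<Lambda>" using x decomposition_sound(1) by auto
  \<comment> \<open>Stated for arbitrary parts, to be used with \<open>x1\<close> and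
    \<open>x2\<close> in either order.\<close>
  have split: "c1 + c2 + d + e \<in> relations"
    if sum: "x1 + x2 + y + z = 0" and mem': "x1 \<in> \<Lambda>" "x2 \<in> \<Lambda>"
      and c: "decomposition \<Lambda> F x1 c1" "decomposition \<Lambda> F x2 c2"
      and less: "triangle_size x1 (y + x2) z < triangle_size x y z"
        "triangle_size x2 y (- (y + x2)) < triangle_size x y z" for x1 x2 c1 c2
  proof -
    obtain r where r: "decomposition \<Lambda> F (y + x2) r"
      using decomposition_exists[of "y + x2"] mem mem' by blast
    have "consistent x1 (y + x2) z"
      using sum mem mem' less(1) by (intro consistent_belowD[OF below]) (auto simp: algebra_simps)
    then have 1: "c1 + r + e \<in> relations" using c(1) r cde(3) by (rule consistentD)
    have "consistent x2 y (- (y + x2))"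
      using mem mem' less(2) by (intro consistent_belowD[OF below]) (auto simp: algebra_simps)
    then have "c2 + d + - r \<in> relations" using c(2) cde(2) decomposition_minus[OF r] by (rule consistentD)
    from relations_add[OF 1 this] show ?thesis by (simp add: algebra_simps)
  qed
  have sum': "x1 + x2 + y + z = 0" using sum x(1) by simp
  have "triangle_size x1 (y + x2) z < triangle_size x y z \<and>
        triangle_size x2 y (- (y + x2)) < triangle_size x y z \<or>
        triangle_size x2 (y + x1) z < triangle_size x y z \<and>
        triangle_size x1 y (- (y + x1)) < triangle_size x y z"
    using acute_triangle_split[OF sum' x(5-7)] acute unfolding x(1) by blast
  then show "c + d + e \<in> relations"
    using split[OF sum' mem' x(3,4)] split[of x2 x1, OF _ mem'(2,1) x(4,3)] sum' x(2)
    by (auto simp: algebra_simps)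
qed

text \<open>Acuteness keeps the three sides distinct up to sign, so their representatives are three
  different elements of \<open>F\<close>, as a line relation requires.\<close>

lemma signed_frag_of_sum_relations:
  assumes ind: "indecomposable \<Lambda> x" "indecomposable \<Lambda> y" "indecomposable \<Lambda> z"
    and sum: "x + y + z = 0" and acute: "x \<bullet> y < 0" "x \<bullet> z < 0" "y \<bullet> z < 0"
  shows "signed_frag_of F x + signed_frag_of F y + signed_frag_of F z \<in> relations"
proof -
  have nz: "x \<noteq> 0" "y \<noteq> 0" "z \<noteq> 0" using acute by auto
  have "x \<noteq> y" "x \<noteq> z" "y \<noteq> z"
    using acute by (metis inner_ge_zero not_le)+
  \<comment> \<open>Two opposite sides would force the third one to vanish.\<close>
  moreover have "x \<noteq> - y" "x \<noteq> - z" "y \<noteq> - z"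
    using sum nz by (auto simp: add.commute add.assoc)
  ultimately have ne: "x \<noteq> y" "x \<noteq> z" "y \<noteq> z" "x \<noteq> - y" "x \<noteq> - z" "y \<noteq> - z"
    by blast+
  obtain f e where x: "f \<in> F" "e \<in> {1, -1}" "x = of_int e *\<^sub>R f" "signed_frag_of F x = frag_cmul e (frag_of f)"
    using signed_frag_of_cases[OF ind(1)] .
  obtain f' e' where y: "f' \<in> F" "e' \<in> {1, -1}" "y = of_int e' *\<^sub>R f'" "signed_frag_of F y = frag_cmul e' (frag_of f')"
    using signed_frag_of_cases[OF ind(2)] .
  obtain f'' e'' where z: "f'' \<in> F" "e'' \<in> {1, -1}" "z = of_int e'' *\<^sub>R f''" "signed_frag_of F z = frag_cmul e'' (frag_of f'')"
    using signed_frag_of_cases[OF ind(3)] .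
  let ?r = "signed_frag_of F x + signed_frag_of F y + signed_frag_of F z"
  have dec: "decomposition \<Lambda> F x (signed_frag_of F x)" "decomposition \<Lambda> F y (signed_frag_of F y)"
    "decomposition \<Lambda> F z (signed_frag_of F z)" using ind by (auto intro: decomposition.indecomposable)
  have ker: "?r \<in> kernel (free_Abelian_group F) (lattice_group \<Lambda>) frag_eval"
    using dec[THEN decomposition_sound(2)] dec[THEN decomposition_sound(3)] sum
    by (simp add: kernel_def lattice_group_def frag_eval_add keys_subset_add)
  have ne': "f \<noteq> f'" "f \<noteq> f''" "f' \<noteq> f''" using x y z ne by auto
  have "?r \<in> line_relations \<Lambda> F"
    unfolding line_relations_def mem_Collect_eq
    by (rule conjI[OF ker], rule bexI[OF _ x(1)], rule bexI[OF _ y(1)], rule bexI[OF _ z(1)],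
        rule bexI[OF _ x(2)], rule bexI[OF _ y(2)], rule bexI[OF _ z(2)])
      (simp add: ne' x(4) y(4) z(4))
  then show ?thesis unfolding relations_def by (rule generate.incl)
qed

text \<open>Size and consistency are symmetric in the sides, so the nonobtuse pair or the
  decomposable side can be moved to the front.\<close>

lemma consistent_step:
  assumes below: "consistent_below (triangle_size x y z)"
    and mem: "x \<in> \<Lambda>" "y \<in> \<Lambda>" "z \<in> \<Lambda>" and sum: "x + y + z = 0"
  shows "consistent x y z"
proof -
  have below': "consistent_below (triangle_size x z y)" "consistent_below (triangle_size y z x)"
    "consistent_below (triangle_size y x z)" "consistent_below (triangle_size z x y)"
    using below by (simp_all add: triangle_size_def max.commute max.left_commute add.commute add.left_commute)
  have sums: "x + z + y = 0" "y + z + x = 0" "y + x + z = 0" "z + x + y = 0"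
    using sum by (simp_all only: add_ac)
  consider "x \<bullet> y \<ge> 0" | "x \<bullet> z \<ge> 0" | "y \<bullet> z \<ge> 0"
    | (acute) "x \<bullet> y < 0" "x \<bullet> z < 0" "y \<bullet> z < 0" by linarith
  then show ?thesis
  proof cases
    case 1
    show ?thesis by (rule consistent_obtuse[OF below sum 1])
  next
    case 2
    show ?thesis
      by (rule consistent_commute23[OF consistent_obtuse[OF below'(1) sums(1) 2]])
  next
    case 3
    show ?thesis
      by (rule consistent_commute12[OF consistent_commute23[OF consistent_obtuse[OF below'(2) sums(2) 3]]])
  next
    case acute
    have acute': "y \<bullet> x < 0" "z \<bullet> x < 0" "z \<bullet> y < 0"
      using acute by (simp_all add: inner_commute)
    consider "indecomposable \<Lambda> x" "indecomposable \<Lambda> y" "indecomposable \<Lambda> z"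
      | "\<not> indecomposable \<Lambda> x" | "\<not> indecomposable \<Lambda> y" | "\<not> indecomposable \<Lambda> z" by blast
    then show ?thesis
    proof cases
      case 1
      show ?thesis
        unfolding consistent_def
      proof (intro allI impI)
        fix a b c
        assume "decomposition \<Lambda> F x a" "decomposition \<Lambda> F y b" "decomposition \<Lambda> F z c"
        then have "a = signed_frag_of F x" "b = signed_frag_of F y" "c = signed_frag_of F z"
          using 1 decomposition_indecomposable by auto
        then show "a + b + c \<in> relations"
          using signed_frag_of_sum_relations[OF 1 sum acute] by simp
      qed
    next
      case 2
      show ?thesis by (rule consistent_acute_decomposable[OF below mem(2,3) sum acute 2])
    next
      case 3
      show ?thesis
        by (rule consistent_commute12[OF consistent_acute_decomposable[OF below'(3) mem(1,3) sums(3)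
                acute'(1) acute(3,2) 3]])
    next
      case 4
      show ?thesis
        by (rule consistent_commute23[OF consistent_commute12[OF consistent_acute_decomposable[OF
                below'(4) mem(1,2) sums(4) acute'(2,3) acute(1) 4]]])
    qed
  qed
qed

lemma consistent_triangle:
  assumes "x \<in> \<Lambda>" "y \<in> \<Lambda>" "z \<in> \<Lambda>" "x + y + z = 0"
  shows "consistent x y z"
proof -
  define S where "S = {(x, y, z). x \<in> \<Lambda> \<and> y \<in> \<Lambda> \<and> z \<in> \<Lambda> \<and> x + y + z = 0}"
  have "case t of (x, y, z) \<Rightarrow> consistent x y z" if "t \<in> S" for t
    using that
  proof (induction t rule: real_measure_induct[where S = S and m = "\<lambda>(x, y, z). triangle_size x y z"])
    case (finite M)
    let ?B = "{v \<in> \<Lambda>. v \<bullet> v \<le> M / 2}"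
    \<comment> \<open>The second term of \<open>triangle_size\<close> bounds each squared side by
      \<open>M / 2\<close>, which leaves finitely many lattice triangles.\<close>
    have "{t \<in> S. (case t of (x, y, z) \<Rightarrow> triangle_size x y z) \<le> M} \<subseteq> ?B \<times> ?B \<times> ?B"
      by (auto simp: S_def triangle_size_def)
    moreover have "finite (?B \<times> ?B \<times> ?B)"
      by (intro finite_cartesian_product finite_euclidean_lattice_inner_le[OF lattice])
    ultimately show ?case by (rule finite_subset)
  next
    case (step t)
    obtain x y z where t: "t = (x, y, z)" by (cases t)
    have "consistent_below (triangle_size x y z)"
      unfolding consistent_below_def
    proof (intro ballI impI)
      fix x' y' z' assume "x' \<in> \<Lambda>" "y' \<in> \<Lambda>" "z' \<in> \<Lambda>" "x' + y' + z' = 0"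
        "triangle_size x' y' z' < triangle_size x y z"
      then show "consistent x' y' z'" using step(2)[of "(x', y', z')"] t by (simp add: S_def)
    qed
    moreover have "x \<in> \<Lambda>" "y \<in> \<Lambda>" "z \<in> \<Lambda>" "x + y + z = 0"
      using step(1) t by (simp_all add: S_def)
    ultimately show ?case using consistent_step t by simp
  qed
  from this[of "(x, y, z)"] show ?thesis using assms by (simp add: S_def)
qed

section \<open>Formal combinations compared with decompositions of their values\<close>

lemma frag_eval_mem:
  assumes "Poly_Mapping.keys c \<subseteq> F" shows "frag_eval c \<in> \<Lambda>"
  using assms
  by (rule free_Abelian_group_induct)
    (use F_indecomposable in \<open>auto simp: frag_eval_diff indecomposable_def\<close>)

text \<open>Induction over differences of generators. A generator is indecomposable, so its only
  decomposition is itself; for a difference, additivity is applied to a triangle of values.\<close>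

lemma diff_decomposition_relations:
  assumes "Poly_Mapping.keys e \<subseteq> F" "decomposition \<Lambda> F (frag_eval e) e'"
  shows "e - e' \<in> relations"
proof -
  have "\<forall>e'. decomposition \<Lambda> F (frag_eval e) e' \<longrightarrow> e - e' \<in> relations"
    using assms(1)
  proof (rule free_Abelian_group_induct)
    show "\<forall>e'. decomposition \<Lambda> F (frag_eval 0) e' \<longrightarrow> 0 - e' \<in> relations"
      by (auto simp: relations_zero dest!: decomposition_zero)
  next
    fix f assume "f \<in> F"
    then have "f \<in> F" "indecomposable \<Lambda> f" using F_indecomposable by auto
    then have "frag_of f - e' \<in> relations" if "decomposition \<Lambda> F f e'" for e'
      using decomposition_indecomposable[OF \<open>indecomposable \<Lambda> f\<close> that] \<open>f \<in> F\<close> by (simp add: signed_frag_of_def relations_zero)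
    then show "\<forall>e'. decomposition \<Lambda> F (frag_eval (frag_of f)) e' \<longrightarrow> frag_of f - e' \<in> relations"
      by simp
  next
    fix a b :: "'a \<Rightarrow>\<^sub>0 int"
    assume IH: "\<forall>e'. decomposition \<Lambda> F (frag_eval a) e' \<longrightarrow> a - e' \<in> relations"
      "\<forall>e'. decomposition \<Lambda> F (frag_eval b) e' \<longrightarrow> b - e' \<in> relations"
      and keys: "Poly_Mapping.keys a \<subseteq> F" "Poly_Mapping.keys b \<subseteq> F"
    obtain a' b' where ab: "decomposition \<Lambda> F (frag_eval a) a'" "decomposition \<Lambda> F (frag_eval b) b'"
      using decomposition_exists frag_eval_mem keys by metis
    show "\<forall>e'. decomposition \<Lambda> F (frag_eval (a - b)) e' \<longrightarrow> (a - b) - e' \<in> relations"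
    proof (intro allI impI)
      fix e' assume e': "decomposition \<Lambda> F (frag_eval (a - b)) e'"
      have "consistent (frag_eval a) (- frag_eval b) (- frag_eval (a - b))"
        using frag_eval_mem keys by (intro consistent_triangle) (auto simp: frag_eval_diff)
      then have "a' + - b' + - e' \<in> relations"
        by (rule consistentD[OF _ ab(1) decomposition_minus[OF ab(2)] decomposition_minus[OF e']])
      moreover have "a - a' \<in> relations" "b - b' \<in> relations" using IH ab by auto
      ultimately have "(a - a') - (b - b') + (a' + - b' + - e') \<in> relations"
        by (simp only: relations_add relations_diff)
      then show "(a - b) - e' \<in> relations" by (simp add: algebra_simps)
    qed
  qed
  with assms(2) show ?thesis by blast
qed

lemma group_hom_frag_eval: "group_hom (free_Abelian_group F) (lattice_group \<Lambda>) frag_eval"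
  by (intro group_hom.intro group_hom_axioms.intro group_free_Abelian_group
      group_lattice_group[OF lattice])
    (auto simp: hom_def lattice_group_def frag_eval_add frag_eval_mem)

lemma frag_eval_surj: "frag_eval ` carrier (free_Abelian_group F) = \<Lambda>"
proof
  show "frag_eval ` carrier (free_Abelian_group F) \<subseteq> \<Lambda>" using frag_eval_mem by auto
  show "\<Lambda> \<subseteq> frag_eval ` carrier (free_Abelian_group F)"
  proof
    fix v assume "v \<in> \<Lambda>"
    then obtain e where "decomposition \<Lambda> F v e" using decomposition_exists by blast
    then have "v = frag_eval e" "e \<in> carrier (free_Abelian_group F)"
      using decomposition_sound by auto
    then show "v \<in> frag_eval ` carrier (free_Abelian_group F)" by blast
  qed
qed

text \<open>A combination with value 0 can be compared with the decomposition 0 of its value, so it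
  is itself a relation.\<close>

lemma kernel_eq_relations:
  "kernel (free_Abelian_group F) (lattice_group \<Lambda>) frag_eval = relations"
proof
  show "relations \<subseteq> kernel (free_Abelian_group F) (lattice_group \<Lambda>) frag_eval"
    unfolding relations_def
    by (rule group.generate_subgroup_incl[OF group_free_Abelian_group _
          group_hom.subgroup_kernel[OF group_hom_frag_eval]])
      (unfold line_relations_def, blast)
  show "kernel (free_Abelian_group F) (lattice_group \<Lambda>) frag_eval \<subseteq> relations"
  proof
    fix e assume "e \<in> kernel (free_Abelian_group F) (lattice_group \<Lambda>) frag_eval"
    then have "Poly_Mapping.keys e \<subseteq> F" "frag_eval e = 0"
      by (auto simp: kernel_def lattice_group_def)
    then show "e \<in> relations"
      using diff_decomposition_relations[of e 0] decomposition.zero[of \<Lambda> F] by simp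
  qed
qed

end

subsection \<open>Exactness\<close>

lemma generate_opposite_pair_reps:
  assumes "opposite_pair_reps L R" "R \<subseteq> carrier (free_Abelian_group F)"
  shows "generate (free_Abelian_group F) L = generate (free_Abelian_group F) R"
proof
  have LR: "L \<subseteq> R" and reps: "\<forall>r\<in>R. \<exists>!y. y \<in> L \<inter> {r, - r}"
    using assms(1) by (simp_all add: opposite_pair_reps_def)
  have opp: "r \<in> L \<or> - r \<in> L" if "r \<in> R" for r
    using ex1_implies_ex[OF bspec[OF reps that]] by auto
  show "generate (free_Abelian_group F) L \<subseteq> generate (free_Abelian_group F) R"
    by (rule group.mono_generate[OF group_free_Abelian_group LR])
  have "R \<subseteq> generate (free_Abelian_group F) L"
  proof
    fix r assume r: "r \<in> R"
    then consider "r \<in> L" | "- r \<in> L" using opp by blast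
    then show "r \<in> generate (free_Abelian_group F) L"
    proof cases
      case 2
      \<comment> \<open>The group inverse is known to be negation only on the carrier.\<close>
      have "Poly_Mapping.keys (- r) \<subseteq> F" using subsetD[OF assms(2) r] by simp
      then show ?thesis using generate.inv[OF 2, of "free_Abelian_group F"] by simp
    qed (rule generate.incl)
  qed
  moreover have "subgroup (generate (free_Abelian_group F) L) (free_Abelian_group F)"
    using LR assms(2) by (intro group.generate_is_subgroup group_free_Abelian_group) blast
  ultimately show "generate (free_Abelian_group F) R \<subseteq> generate (free_Abelian_group F) L"
    by (rule group.generate_subgroup_incl[OF group_free_Abelian_group])
qed

lemma group_hom_relation_incl:
  assumes "L \<subseteq> carrier (free_Abelian_group F)"
  shows "group_hom (free_Abelian_group L) (free_Abelian_group F) relation_incl"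
proof -
  have L: "Poly_Mapping.keys r \<subseteq> F" if "r \<in> L" for r
    using subsetD[OF assms that] by simp
  have "Poly_Mapping.keys (relation_incl c) \<subseteq> F" if "Poly_Mapping.keys c \<subseteq> L" for c
    using that
    by (rule free_Abelian_group_induct)
      (simp_all add: L relation_incl_def frag_extend_diff keys_subset_diff)
  then show ?thesis
    by (intro group_hom.intro group_hom_axioms.intro group_free_Abelian_group)
      (auto simp: hom_def relation_incl_def frag_extend_add)
qed

text \<open>The image is the least subgroup containing \<open>L\<close>: it is a subgroup, basis
  elements map onto \<open>L\<close>, and induction puts it inside every subgroup that contains
  \<open>L\<close>.\<close>

lemma relation_incl_image:
  assumes "L \<subseteq> carrier (free_Abelian_group F)"
  shows "relation_incl ` carrier (free_Abelian_group L) = generate (free_Abelian_group F) L"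
proof (rule group.generateI[OF group_free_Abelian_group])
  interpret group_hom "free_Abelian_group L" "free_Abelian_group F" relation_incl
    by (rule group_hom_relation_incl[OF assms])
  show "subgroup (relation_incl ` carrier (free_Abelian_group L)) (free_Abelian_group F)"
    by (rule img_is_subgroup)
  show "L \<subseteq> relation_incl ` carrier (free_Abelian_group L)"
  proof
    fix r assume "r \<in> L"
    then show "r \<in> relation_incl ` carrier (free_Abelian_group L)"
      by (intro image_eqI[of _ _ "frag_of r"]) (auto simp: relation_incl_def)
  qed
  show "relation_incl ` carrier (free_Abelian_group L) \<subseteq> K"
    if K: "subgroup K (free_Abelian_group F)" "L \<subseteq> K" for K
  proof safe
    fix c assume "c \<in> carrier (free_Abelian_group L)"
    then have "Poly_Mapping.keys c \<subseteq> L" by simp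
    then show "relation_incl c \<in> K"
    proof (rule free_Abelian_group_induct)
      show "relation_incl 0 \<in> K"
        using subgroup.one_closed[OF K(1)] by (simp add: relation_incl_def)
      show "relation_incl (frag_of r) \<in> K" if "r \<in> L" for r
        using K(2) that by (auto simp: relation_incl_def)
      fix a b assume ab: "relation_incl a \<in> K" "relation_incl b \<in> K"
      have "Poly_Mapping.keys (relation_incl b) \<subseteq> F"
        using subsetD[OF subgroup.subset[OF K(1)] ab(2)] by simp
      then have b: "- relation_incl b \<in> K" using subgroup.m_inv_closed[OF K(1) ab(2)] by simp
      have "relation_incl a + - relation_incl b \<in> K"
        using subgroup.m_closed[OF K(1) ab(1) b] by simp
      then show "relation_incl (a - b) \<in> K" by (simp add: relation_incl_def frag_extend_diff)
    qed
  qed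
qed

theorem theorem2p1:
  fixes \<Lambda> F :: "'a::euclidean_space set" and L :: "('a \<Rightarrow>\<^sub>0 int) set"
  assumes "euclidean_lattice \<Lambda>"
    and "opposite_pair_reps F {f. facet_vector \<Lambda> f}"
    and "opposite_pair_reps L (line_relations \<Lambda> F)"
  shows "exact_at (free_Abelian_group L) relation_incl (free_Abelian_group F) frag_eval (lattice_group \<Lambda>)
    \<and> exact_at (free_Abelian_group F) frag_eval (lattice_group \<Lambda>) (\<lambda>_. 0) (singleton_group (0::'a))
    \<and> relation_incl ` carrier (free_Abelian_group L)
        = kernel (free_Abelian_group F) (lattice_group \<Lambda>) frag_eval
    \<and> kernel (free_Abelian_group F) (lattice_group \<Lambda>) frag_eval
        = generate (free_Abelian_group F) L
    \<and> generate (free_Abelian_group F) L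
        = generate (free_Abelian_group F) (line_relations \<Lambda> F)"
proof -
  interpret lattice_facet_reps \<Lambda> F using assms by unfold_locales
  have L: "L \<subseteq> carrier (free_Abelian_group F)"
    using assms(3) line_relations_subset unfolding opposite_pair_reps_def by blast
  have gen: "generate (free_Abelian_group F) L = generate (free_Abelian_group F) (line_relations \<Lambda> F)"
    by (rule generate_opposite_pair_reps[OF assms(3) line_relations_subset])
  then have ker: "kernel (free_Abelian_group F) (lattice_group \<Lambda>) frag_eval
      = generate (free_Abelian_group F) L"
    using kernel_eq_relations relations_def by simp
  have "group_hom (lattice_group \<Lambda>) (singleton_group (0::'a)) (\<lambda>_. 0)"
    by (intro group_hom.intro group_hom_axioms.intro group_lattice_group[OF lattice] singleton_group)
      (auto simp: hom_def singleton_group_def)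
  \<comment> \<open>The kernel of the zero map is everything, so exactness at the lattice amounts to
    surjectivity of \<open>frag_eval\<close>.\<close>
  moreover have "kernel (lattice_group \<Lambda>) (singleton_group (0::'a)) (\<lambda>_. 0) = \<Lambda>"
    by (auto simp: kernel_def lattice_group_def singleton_group_def)
  ultimately show ?thesis
    unfolding exact_at_def
    using gen ker relation_incl_image[OF L] group_hom_relation_incl[OF L] group_hom_frag_eval
      frag_eval_surj by simp
qed

end
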